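(* Let $(S,d_S)$ be a complete separable metric space (with its Borel $\sigma$-algebra) of finite diameter, let $d\ge 1$ and $\Omega=S^{\mathbb{Z}^d}$, and assume that the set of bounded quasi-local functions on $\Omega$ is measure separating. Let $C>0$ and let $\mu$ be a translation-invariant probability measure on $\Omega$ that satisfies $\mathrm{GCB}(C)$. Then for every translation-invariant probability measure $\mu'$ on $\Omega$, $$s_*(\mu'|\mu)\ \ge\ \frac{d(\mu',\mu)^2}{2C},$$ where $d(\cdot,\cdot)$ is the distance between probability measures defined by $$d(\mu,\mu')=\sup\Big\{\int f\,d\mu-\int f\,d\mu' : f \text{ local},\ \|\delta f\|_1\le1\Big\}.$$
   Context: $\Omega=S^{\mathbb{Z}^d}$ carries the product topology and the product $\sigma$-algebra $\mathfrak{B}$; all probability measures on $\Omega$ are defined on $\mathfrak{B}$. For $i\in\mathbb{Z}^d$ and $\sigma\in\Omega$ put $(\tau_i\sigma)_j=\sigma_{j-i}$ for all $j\in\mathbb{Z}^d$. A probability measure $\mu$ on $\Omega$ is translation invariant if $\mu(\tau_iB)=\mu(B)$ for all $B\in\mathfrak{B}$, $i\in\mathbb{Z}^d$. For continuous $f:\Omega\to\mathbb{R}$ and $i\in\mathbb{Z}^d$, the local oscillation is $\delta_if=\sup\{f(\sigma)-f(\eta):\sigma,\eta\in\Omega,\ \sigma_j=\eta_j\ \forall j\neq i\}\in[0,\infty]$, with $\|\delta f\|_1=\sum_{i\in\mathbb{Z}^d}\delta_if$ and $\|\delta f\|_2^2=\sum_{i\in\mathbb{Z}^d}(\delta_if)^2$.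 A continuous function $f$ is local if $\delta_if\neq0$ for only finitely many $i$; a continuous function is quasi-local if it is a uniform limit of local functions. Measure separating means: for any two distinct probability measures $\mu,\mu'$ on $\Omega$ there is a bounded quasi-local $f$ with $\int f\,d\mu\neq\int f\,d\mu'$. $\mu$ satisfies $\mathrm{GCB}(C)$ if for all bounded local functions $f$, $\int e^{f-\int f\,d\mu}\,d\mu\le e^{\frac{C}{2}\|\delta f\|_2^2}$. For finite $\Lambda\subset\mathbb{Z}^d$, $\mu_\Lambda$ denotes the restriction of $\mu$ to the $\sigma$-algebra $\mathfrak{B}_\Lambda$ generated by the coordinates $\eta_i$, $i\in\Lambda$. The relative entropy is $s_\Lambda(\mu'|\mu)=\int d\mu'_\Lambda\,\log\frac{d\mu'_\Lambda}{d\mu_\Lambda}$ if $\mu'_\Lambda\ll\mu_\Lambda$, and $+\infty$ otherwise. With $\Lambda_n=[-n,n]^d\cap\mathbb{Z}^d$, the lower relative entropy density is $s_*(\mu'|\mu)=\liminf_{n\to\infty}\frac{s_{\Lambda_n}(\mu'|\mu)}{|\Lambda_n|}$. (The symbol $d$ is used both for the lattice dimension and for the distance between measures.) *)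

theory Defs
  imports "HOL-Probability.Probability"
begin

type_synonym 'd site = "int ^ 'd"
type_synonym ('d, 's) config = "'d site \<Rightarrow> 's"

definition config_algebra :: "('d::finite, 's::topological_space) config measure" where
  "config_algebra = PiM UNIV (\<lambda>_. borel)"

definition config_prob :: "('d::finite, 's::topological_space) config measure \<Rightarrow> bool" where
  "config_prob \<mu> \<longleftrightarrow> prob_space \<mu> \<and> sets \<mu> = sets config_algebra"

definition shift :: "'d::finite site \<Rightarrow> ('d, 's) config \<Rightarrow> ('d, 's) config" where
  "shift i \<sigma> = (\<lambda>j. \<sigma> (j - i))"

definition translation_invariant :: "('d::finite, 's::topological_space) config measure \<Rightarrow> bool" where
  "translation_invariant \<mu> \<longleftrightarrow>
     (\<forall>i. \<forall>B\<in>sets config_algebra. emeasure \<mu> (shift i ` B) = emeasure \<mu> B)"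

(* The coercion ennreal truncates negative differences to 0; this does not change the supremum,
   since the choice \<sigma> = \<eta> contributes 0. *)
definition oscillation :: "'d::finite site \<Rightarrow> (('d, 's) config \<Rightarrow> real) \<Rightarrow> ennreal" where
  "oscillation i f =
     (SUP (\<sigma>, \<eta>)\<in>{(\<sigma>, \<eta>). \<forall>j. j \<noteq> i \<longrightarrow> \<sigma> j = \<eta> j}. ennreal (f \<sigma> - f \<eta>))"

definition osc_norm1 :: "(('d::finite, 's) config \<Rightarrow> real) \<Rightarrow> ennreal" where
  "osc_norm1 f = (\<Sum>\<^sub>\<infinity>i. oscillation i f)"

definition osc_norm2_sq :: "(('d::finite, 's) config \<Rightarrow> real) \<Rightarrow> ennreal" where
  "osc_norm2_sq f = (\<Sum>\<^sub>\<infinity>i. (oscillation i f)\<^sup>2)"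

definition local_fun :: "(('d::finite, 's::topological_space) config \<Rightarrow> real) \<Rightarrow> bool" where
  "local_fun f \<longleftrightarrow> continuous_on UNIV f \<and> finite {i. oscillation i f \<noteq> 0}"

definition quasi_local :: "(('d::finite, 's::topological_space) config \<Rightarrow> real) \<Rightarrow> bool" where
  "quasi_local f \<longleftrightarrow> continuous_on UNIV f \<and>
     (\<exists>g. (\<forall>n. local_fun (g n)) \<and> uniform_limit UNIV g f sequentially)"

definition measure_separating :: "(('d::finite, 's::topological_space) config \<Rightarrow> real) set \<Rightarrow> bool" where
  "measure_separating F \<longleftrightarrow>
     (\<forall>\<mu> \<mu>'. config_prob \<mu> \<longrightarrow> config_prob \<mu>' \<longrightarrow> \<mu> \<noteq> \<mu>' \<longrightarrow>
        (\<exists>f\<in>F. (\<integral>\<sigma>. f \<sigma> \<partial>\<mu>) \<noteq> (\<integral>\<sigma>. f \<sigma> \<partial>\<mu>')))"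

(* For bounded local f the quantity osc_norm2_sq f is finite, so enn2real loses nothing. *)
definition GCB :: "real \<Rightarrow> ('d::finite, 's::topological_space) config measure \<Rightarrow> bool" where
  "GCB C \<mu> \<longleftrightarrow>
     (\<forall>f. bounded (range f) \<longrightarrow> local_fun f \<longrightarrow>
        (\<integral>\<sigma>. exp (f \<sigma> - (\<integral>\<eta>. f \<eta> \<partial>\<mu>)) \<partial>\<mu>) \<le> exp (C / 2 * enn2real (osc_norm2_sq f)))"

definition coord_algebra :: "'d::finite site set \<Rightarrow> ('d, 's::topological_space) config measure" where
  "coord_algebra \<Lambda> = sigma UNIV (\<Union>i\<in>\<Lambda>. {{\<eta>. \<eta> i \<in> A} | A. A \<in> sets borel})"

definition restrict_to ::
    "'d::finite site set \<Rightarrow> ('d, 's::topological_space) config measure \<Rightarrow> ('d, 's) config measure" where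
  "restrict_to \<Lambda> \<mu> = restr_to_subalg \<mu> (coord_algebra \<Lambda>)"

(* The integral of the logarithmic density is taken in the extended sense (positive minus negative
   part), because it can be infinite even under absolute continuity, whereas the Bochner integral
   in KL_divergence is then 0. The negative part is always finite for probability measures.
   The reference measure is the first argument of entropy_density. *)
definition rel_entropy :: "'a measure \<Rightarrow> 'a measure \<Rightarrow> ereal" where
  "rel_entropy \<nu>' \<nu> =
     (if absolutely_continuous \<nu> \<nu>'
      then enn2ereal (\<integral>\<^sup>+\<sigma>. ennreal (entropy_density (exp 1) \<nu> \<nu>' \<sigma>) \<partial>\<nu>')
         - enn2ereal (\<integral>\<^sup>+\<sigma>. ennreal (- entropy_density (exp 1) \<nu> \<nu>' \<sigma>) \<partial>\<nu>')
      else \<infinity>)"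

definition local_rel_entropy :: "'d::finite site set \<Rightarrow>
    ('d, 's::topological_space) config measure \<Rightarrow> ('d, 's) config measure \<Rightarrow> ereal" where
  "local_rel_entropy \<Lambda> \<mu>' \<mu> = rel_entropy (restrict_to \<Lambda> \<mu>') (restrict_to \<Lambda> \<mu>)"

definition box :: "nat \<Rightarrow> 'd::finite site set" where
  "box n = {i. \<forall>k. - int n \<le> i $ k \<and> i $ k \<le> int n}"

definition lower_entropy_density ::
    "('d::finite, 's::topological_space) config measure \<Rightarrow> ('d, 's) config measure \<Rightarrow> ereal" where
  "lower_entropy_density \<mu>' \<mu> =
     liminf (\<lambda>n. local_rel_entropy (box n) \<mu>' \<mu> / ereal (real (card (box n :: 'd site set))))"

definition local_dist ::
    "('d::finite, 's::topological_space) config measure \<Rightarrow> ('d, 's) config measure \<Rightarrow> ereal" where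
  "local_dist \<mu> \<mu>' =
     (SUP f\<in>{f. local_fun f \<and> osc_norm1 f \<le> 1}. ereal ((\<integral>\<sigma>. f \<sigma> \<partial>\<mu>) - (\<integral>\<sigma>. f \<sigma> \<partial>\<mu>')))"

end

(* Let f be local with ||delta f||_1 <= 1, and let a >= 0 be the difference of its integrals against
   mu' and mu. The sum F of the N translates of f that depend only on the box satisfies
   ||delta F||_2^2 <= N by Young's inequality, so GCB(C) bounds the exponential moment of the centred
   function t F by exp (C t^2 N / 2). The Donsker-Varadhan inequality on the box then bounds the
   relative entropy from below by N (t a - C t^2 / 2), which is N a^2 / (2 C) for t = a / C.
   Finally, N divided by the size of the box tends to 1. *)
theory Submission
  imports Defs "HOL-Real_Asymp.Real_Asymp"
begin

section \<open>Relative entropy and the Donsker-Varadhan inequality\<close>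

text \<open>The negative part of \<open>l\<close> is dominated by that of \<open>w\<close>, so its
  integral is finite and the difference never has the form \<infinity> - \<infinity>. Either the
  positive part has infinite integral and the bound is trivial, or \<open>l\<close> is integrable
  and monotonicity applies. This lets a real integral bound the extended integral in
  \<open>rel_entropy\<close> from below.\<close>

lemma integral_le_nn_integral_diff:
  fixes w l :: "'a \<Rightarrow> real"
  assumes w: "integrable M w" and l[measurable]: "l \<in> borel_measurable M"
    and le: "AE x in M. w x \<le> l x"
  shows "ereal (\<integral>x. w x \<partial>M)
    \<le> enn2ereal (\<integral>\<^sup>+x. ennreal (l x) \<partial>M) - enn2ereal (\<integral>\<^sup>+x. ennreal (- l x) \<partial>M)"
proof -
  let ?P = "\<integral>\<^sup>+x. ennreal (l x) \<partial>M" and ?N = "\<integral>\<^sup>+x. ennreal (- l x) \<partial>M"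
  have "?N \<le> (\<integral>\<^sup>+x. ennreal (- w x) \<partial>M)"
    using le by (intro nn_integral_mono_AE) (auto elim!: eventually_mono simp: ennreal_leI)
  also have "\<dots> < \<infinity>"
    using w by (auto simp: real_integrable_def less_top)
  finally have N: "?N < \<infinity>" .
  show ?thesis
  proof (cases "?P = \<infinity>")
    case True
    then show ?thesis using N by (cases ?N) auto
  next
    case False
    with N have int: "integrable M l" by (auto simp: real_integrable_def)
    have "(\<integral>x. w x \<partial>M) \<le> (\<integral>x. l x \<partial>M)"
      by (rule integral_mono_AE[OF w int le])
    also have "\<dots> = enn2real ?P - enn2real ?N"
      by (rule real_lebesgue_integral_def[OF int])
    finally show ?thesis using N False by (cases ?N; cases ?P) auto
  qed
qed

text \<open>The Donsker-Varadhan inequality, with an upper bound \<open>K\<close> for the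
  logarithmic moment in place of its value, since a concentration bound supplies only that. It comes
  from integrating ln y \<le> y - 1 against \<open>\<nu>'\<close>, where y is exp (u - K) divided by
  the density of \<open>\<nu>'\<close>.\<close>

lemma rel_entropy_variational:
  fixes u :: "'a \<Rightarrow> real"
  assumes \<nu>: "prob_space \<nu>" and \<nu>': "prob_space \<nu>'" and sets: "sets \<nu>' = sets \<nu>"
    and u[measurable]: "u \<in> borel_measurable \<nu>" and bnd: "\<And>x. \<bar>u x\<bar> \<le> B"
    and exp_le: "(\<integral>x. exp (u x) \<partial>\<nu>) \<le> exp K"
  shows "ereal ((\<integral>x. u x \<partial>\<nu>') - K) \<le> rel_entropy \<nu>' \<nu>"
proof (cases "absolutely_continuous \<nu> \<nu>'")
  case False
  then show ?thesis by (simp add: rel_entropy_def)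
next
  case ac: True
  interpret P: prob_space \<nu> by fact
  interpret P': prob_space \<nu>' by fact
  define h where "h = (\<lambda>x. enn2real (RN_deriv \<nu> \<nu>' x))"
  have h[measurable]: "h \<in> borel_measurable \<nu>" unfolding h_def by measurable
  have h0: "h x \<ge> 0" for x by (simp add: h_def)
  have dens: "\<nu>' = density \<nu> (\<lambda>x. ennreal (h x))"
  proof -
    have "\<nu>' = density \<nu> (RN_deriv \<nu> \<nu>')"
      using P.density_RN_deriv[OF ac sets] by simp
    also have "\<dots> = density \<nu> (\<lambda>x. ennreal (h x))"
    proof (intro density_cong)
      show "AE x in \<nu>. RN_deriv \<nu> \<nu>' x = ennreal (h x)"
        using P.RN_deriv_finite[OF P'.sigma_finite_measure_axioms ac sets]
        by eventually_elim (simp add: h_def less_top)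
    qed auto
    finally show ?thesis .
  qed
  have u'[measurable]: "u \<in> borel_measurable \<nu>'" and h'[measurable]: "h \<in> borel_measurable \<nu>'"
    using u h by (simp_all add: measurable_cong_sets[OF sets refl])
  have pos: "AE x in \<nu>'. h x > 0"
    by (subst dens, subst AE_density) auto
  \<comment> \<open>Where \<open>h\<close> vanishes, \<open>e\<close> is 0 by the convention for
    division. That set is null for \<open>\<nu>'\<close> but possibly not for \<open>\<nu>\<close>,
    which is why the mean of \<open>e\<close> is only bounded by 1 below.\<close>
  define e where "e = (\<lambda>x. exp (u x - K) / h x)"
  have e0: "e x \<ge> 0" for x by (simp add: e_def h0)
  have e[measurable]: "e \<in> borel_measurable \<nu>" and e'[measurable]: "e \<in> borel_measurable \<nu>'"
    unfolding e_def by measurable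
  have iexp: "integrable \<nu> (\<lambda>x. exp (u x - K))"
  proof (rule P.integrable_const_bound[where B = "exp (B - K)"])
    show "AE x in \<nu>. norm (exp (u x - K)) \<le> exp (B - K)"
    proof (rule AE_I2)
      fix x show "norm (exp (u x - K)) \<le> exp (B - K)" using bnd[of x] by auto
    qed
  qed auto
  have ne: "(\<integral>\<^sup>+x. ennreal (e x) \<partial>\<nu>') \<le> 1"
  proof -
    have "(\<integral>\<^sup>+x. ennreal (e x) \<partial>\<nu>') = (\<integral>\<^sup>+x. ennreal (h x) * ennreal (e x) \<partial>\<nu>)"
      by (subst dens, subst nn_integral_density) auto
    also have "\<dots> \<le> (\<integral>\<^sup>+x. ennreal (exp (u x - K)) \<partial>\<nu>)"
      using h0 by (intro nn_integral_mono) (auto simp: e_def simp flip: ennreal_mult')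
    also have "\<dots> = ennreal (\<integral>x. exp (u x - K) \<partial>\<nu>)"
      by (rule nn_integral_eq_integral[OF iexp]) auto
    also have "(\<integral>x. exp (u x - K) \<partial>\<nu>) = (\<integral>x. exp (u x) \<partial>\<nu>) / exp K"
      by (simp add: exp_diff)
    also have "ennreal \<dots> \<le> 1"
      using exp_le by simp
    finally show ?thesis .
  qed
  have ie: "integrable \<nu>' e"
  proof (rule integrableI_bounded)
    show "(\<integral>\<^sup>+x. ennreal (norm (e x)) \<partial>\<nu>') < \<infinity>"
      using ne by (simp add: e0 order.strict_trans1)
  qed auto
  have "ennreal (\<integral>x. e x \<partial>\<nu>') \<le> 1"
    using ne nn_integral_eq_integral[OF ie] e0 by simp
  then have ie1: "(\<integral>x. e x \<partial>\<nu>') \<le> 1" by simp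
  have iu: "integrable \<nu>' u"
    by (rule P'.integrable_const_bound[where B = B]) (auto simp: bnd)
  \<comment> \<open>Solving ln e \<le> e - 1 for ln h gives this integrable minorant of ln h. Its
    mean is at least that of u - K because \<open>e\<close> has mean at most 1.\<close>
  define w where "w = (\<lambda>x. u x - K + 1 - e x)"
  have iw: "integrable \<nu>' w" unfolding w_def using iu ie by auto
  have "(\<integral>x. w x \<partial>\<nu>') = (\<integral>x. u x \<partial>\<nu>') - K + 1 - (\<integral>x. e x \<partial>\<nu>')"
    unfolding w_def using iu ie by (simp add: P'.prob_space)
  then have "ereal ((\<integral>x. u x \<partial>\<nu>') - K) \<le> ereal (\<integral>x. w x \<partial>\<nu>')"
    using ie1 by simp
  also have "\<dots> \<le> rel_entropy \<nu>' \<nu>"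
  proof -
    have ed: "entropy_density (exp 1) \<nu> \<nu>' = (\<lambda>x. ln (h x))"
      by (auto simp: entropy_density_def h_def log_def)
    have "AE x in \<nu>'. w x \<le> ln (h x)"
      using pos
    proof eventually_elim
      case (elim x)
      have "ln (e x) \<le> e x - 1" using elim by (intro ln_le_minus_one) (simp add: e_def)
      moreover have "ln (e x) = u x - K - ln (h x)" using elim by (simp add: e_def ln_div)
      ultimately show ?case by (simp add: w_def)
    qed
    from integral_le_nn_integral_diff[OF iw _ this]
    show ?thesis using ac by (simp add: rel_entropy_def ed)
  qed
  finally show ?thesis .
qed

section \<open>Lattice boxes and their volumes\<close>

lemma card_box: "card (box n :: 'd::finite site set) = (2 * n + 1) ^ CARD('d)"
proof -
  have "bij_betw vec_nth (box n :: 'd site set) (PiE UNIV (\<lambda>_. {- int n..int n}))"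
    by (rule bij_betwI[where g = vec_lambda]) (auto simp: box_def)
  then have "card (box n :: 'd site set) = card (PiE (UNIV :: 'd set) (\<lambda>_. {- int n..int n}))"
    by (rule bij_betw_same_card)
  also have "\<dots> = (2 * n + 1) ^ CARD('d)"
    by (simp add: card_PiE nat_add_distrib nat_mult_distrib)
  finally show ?thesis .
qed

lemma finite_box: "finite (box n :: 'd::finite site set)"
  by (rule card_ge_0_finite) (simp add: card_box)

lemma box_mono: "a \<le> b \<Longrightarrow> box a \<subseteq> box b"
  unfolding box_def by clarsimp (smt (verit) of_nat_mono)

lemma finite_subset_box:
  assumes "finite (D :: 'd::finite site set)"
  shows "\<exists>m. D \<subseteq> box m"
  using assms
proof induction
  case (insert i D)
  then obtain m where m: "D \<subseteq> box m" by blast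
  \<comment> \<open>The l1 norm of \<open>i\<close> dominates each of its coordinates; adding it to
    \<open>m\<close> keeps the inclusion of \<open>D\<close>.\<close>
  define k where "k = m + (\<Sum>c\<in>UNIV. nat \<bar>i $ c\<bar>)"
  have "nat \<bar>i $ c\<bar> \<le> (\<Sum>c\<in>UNIV. nat \<bar>i $ c\<bar>)" for c
    by (rule member_le_sum) auto
  then have "nat \<bar>i $ c\<bar> \<le> k" for c
    unfolding k_def by (rule trans_le_add2)
  then have "\<bar>i $ c\<bar> \<le> int k" for c
    by (simp add: nat_le_iff)
  then have "i \<in> box k" by (auto simp: box_def abs_le_iff minus_le_iff)
  moreover have "D \<subseteq> box k"
    using m box_mono[of m k] by (auto simp: k_def)
  ultimately show ?case by blast
qed auto

lemma box_add: "i \<in> box a \<Longrightarrow> j \<in> box b \<Longrightarrow> i + j \<in> box (a + b)"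
  unfolding box_def by clarsimp (smt (verit))

lemma box_ratio_tendsto:
  "(\<lambda>n. real (card (box (n - m) :: 'd::finite site set)) / real (card (box n :: 'd site set))) \<longlonglongrightarrow> 1"
proof -
  have lim: "(\<lambda>n. (2 * (real n - real m) + 1) / (2 * real n + 1)) \<longlonglongrightarrow> 1"
    by real_asymp
  \<comment> \<open>Subtraction of naturals is truncated, so the closed form of the ratio is claimed
    only for n \<ge> m.\<close>
  have "eventually (\<lambda>n. real (card (box (n - m) :: 'd site set)) / real (card (box n :: 'd site set))
      = ((2 * (real n - real m) + 1) / (2 * real n + 1)) ^ CARD('d)) sequentially"
    using eventually_ge_at_top[of m]
    by eventually_elim (simp add: card_box power_divide of_nat_diff algebra_simps)
  moreover have "(\<lambda>n. ((2 * (real n - real m) + 1) / (2 * real n + 1)) ^ CARD('d)) \<longlonglongrightarrow> 1"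
    using tendsto_power[OF lim, of "CARD('d)"] by simp
  ultimately show ?thesis by (simp add: tendsto_cong)
qed

section \<open>Oscillations and the coordinates on which a local function depends\<close>

text \<open>Truncation of negative reals at 0 leaves only subadditivity. In this form it applies to
  differences of function values of either sign.\<close>

lemma ennreal_add_le: "ennreal (a + b) \<le> ennreal a + ennreal b"
proof -
  have "ennreal (a + b) \<le> ennreal (max 0 a + max 0 b)"
    by (intro ennreal_leI) auto
  also have "\<dots> = ennreal a + ennreal b"
    by (subst ennreal_plus) (auto simp: max_def ennreal_neg)
  finally show ?thesis .
qed

lemma ennreal_sum_le: "ennreal (\<Sum>i\<in>I. a i) \<le> (\<Sum>i\<in>I. ennreal (a i))"
proof (induction I rule: infinite_finite_induct)
  case (insert i I)
  then show ?case
    by simp (meson ennreal_add_le add_left_mono order_trans)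
qed auto

lemma sum_le_infsum_ennreal:
  fixes g :: "'a \<Rightarrow> ennreal"
  assumes "finite J"
  shows "(\<Sum>i\<in>J. g i) \<le> (\<Sum>\<^sub>\<infinity>i. g i)"
  by (subst nonneg_infsum_complete) (auto intro: SUP_upper2[of J] assms)

lemma infsum_le_ennreal:
  fixes g :: "'a \<Rightarrow> ennreal"
  assumes "\<And>J. finite J \<Longrightarrow> (\<Sum>i\<in>J. g i) \<le> b"
  shows "(\<Sum>\<^sub>\<infinity>i. g i) \<le> b"
  by (subst nonneg_infsum_complete) (auto intro: SUP_least assms)

lemma le_oscillation:
  assumes "\<And>j. j \<noteq> i \<Longrightarrow> \<sigma> j = \<eta> j"
  shows "ennreal (f \<sigma> - f \<eta>) \<le> oscillation i f"
  unfolding oscillation_def using assms by (intro SUP_upper2[of "(\<sigma>, \<eta>)"]) auto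

text \<open>Turning \<sigma> into \<eta> one site at a time telescopes the difference, and the
  change at site i costs at most \<open>oscillation i f\<close>.\<close>

lemma diff_le_sum_oscillation:
  assumes "finite D" "\<And>j. j \<notin> D \<Longrightarrow> \<sigma> j = \<eta> j"
  shows "ennreal (f \<sigma> - f \<eta>) \<le> (\<Sum>i\<in>D. oscillation i f)"
  using assms
proof (induction D arbitrary: \<sigma>)
  case empty
  then have "\<sigma> = \<eta>" by auto
  then show ?case by simp
next
  case (insert i D)
  let ?\<sigma> = "\<sigma>(i := \<eta> i)"
  have "ennreal (f \<sigma> - f \<eta>) = ennreal ((f \<sigma> - f ?\<sigma>) + (f ?\<sigma> - f \<eta>))" by simp
  also have "\<dots> \<le> ennreal (f \<sigma> - f ?\<sigma>) + ennreal (f ?\<sigma> - f \<eta>)"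
    by (rule ennreal_add_le)
  also have "\<dots> \<le> oscillation i f + (\<Sum>i\<in>D. oscillation i f)"
    using insert.prems by (intro add_mono le_oscillation insert.IH) auto
  finally show ?case using insert.hyps by simp
qed

text \<open>Vanishing oscillations only control changes at finitely many sites. Continuity in the
  product topology extends this to infinitely many, by approximating \<eta> with finite
  modifications of \<sigma>.\<close>

lemma local_fun_cong:
  fixes f :: "('d::finite, 's::topological_space) config \<Rightarrow> real"
  assumes f: "local_fun f" and eq: "\<And>i. oscillation i f \<noteq> 0 \<Longrightarrow> \<sigma> i = \<eta> i"
  shows "f \<sigma> = f \<eta>"
proof -
  have "f \<sigma> \<le> f \<eta>" if eq: "\<And>i. oscillation i f \<noteq> 0 \<Longrightarrow> \<sigma> i = \<eta> i" for \<sigma> \<eta>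
  proof -
    \<comment> \<open>Each coordinate of \<open>g J\<close> equals that of \<eta> as soon as
      \<open>J\<close> contains its site, so \<open>g\<close> converges to \<eta> along the finite
      subsets.\<close>
    define g where "g = (\<lambda>J i. if i \<in> J then \<eta> i else \<sigma> i)"
    let ?F = "finite_subsets_at_top (UNIV :: 'd site set)"
    have "((\<lambda>J. g J i) \<longlongrightarrow> \<eta> i) ?F" for i
      by (rule tendsto_eventually)
        (auto simp: eventually_finite_subsets_at_top g_def intro!: exI[of _ "{i}"])
    then have "limitin (product_topology (\<lambda>_. euclidean) UNIV) g \<eta> ?F"
      by (subst limitin_componentwise) auto
    then have "(g \<longlongrightarrow> \<eta>) ?F"
      by (simp add: euclidean_product_topology)
    then have lim: "((\<lambda>J. f (g J)) \<longlongrightarrow> f \<eta>) ?F"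
      using f by (auto simp: local_fun_def elim!: continuous_on_tendsto_compose)
    have "f \<sigma> \<le> f (g J)" if "finite J" for J
    proof -
      \<comment> \<open>At the sites of \<open>J\<close> with nonzero oscillation \<sigma> and
        \<eta> agree by assumption, so \<sigma> and \<open>g J\<close> differ at most on
        \<open>?D\<close>, where every oscillation vanishes.\<close>
      let ?D = "J \<inter> {i. oscillation i f = 0}"
      have "ennreal (f \<sigma> - f (g J)) \<le> (\<Sum>i\<in>?D. oscillation i f)"
        using that eq by (intro diff_le_sum_oscillation) (auto simp: g_def)
      also have "\<dots> = 0" by simp
      finally show ?thesis by (simp add: ennreal_eq_0_iff)
    qed
    then have "\<forall>\<^sub>F J in ?F. f \<sigma> \<le> f (g J)"
      by (auto simp: eventually_finite_subsets_at_top)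
    then show ?thesis
      by (rule tendsto_lowerbound[OF lim]) simp
  qed
  from this[of \<sigma> \<eta>] this[of \<eta> \<sigma>] eq show ?thesis by force
qed

text \<open>Replacing \<sigma> by \<eta> off the finite support of the oscillations does not change
  the value of \<open>f\<close>, so the telescoping bound for finitely many sites applies. This
  gives boundedness, which \<open>GCB\<close> demands of its test functions and
  \<open>local_dist\<close> does not.\<close>

lemma local_fun_diff_le:
  assumes f: "local_fun f" and norm: "osc_norm1 f \<le> 1"
  shows "f \<sigma> - f \<eta> \<le> 1"
proof -
  let ?D = "{i. oscillation i f \<noteq> 0}"
  define \<sigma>' where "\<sigma>' = (\<lambda>i. if i \<in> ?D then \<sigma> i else \<eta> i)"
  have D: "finite ?D" using f by (simp add: local_fun_def)
  have "f \<sigma> = f \<sigma>'" by (rule local_fun_cong[OF f]) (auto simp: \<sigma>'_def)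
  then have "ennreal (f \<sigma> - f \<eta>) = ennreal (f \<sigma>' - f \<eta>)" by simp
  also have "\<dots> \<le> (\<Sum>i\<in>?D. oscillation i f)"
    by (rule diff_le_sum_oscillation[OF D]) (simp add: \<sigma>'_def)
  also have "\<dots> \<le> 1"
    using sum_le_infsum_ennreal[OF D] norm by (auto simp: osc_norm1_def intro: order_trans)
  finally show ?thesis by simp
qed

section \<open>Sums of translates and Young's inequality\<close>

text \<open>The configuration \<open>shift (- i) \<sigma>\<close> has the value \<sigma> (k + i) at
  k. With this sign the summand for \<open>i\<close> depends on the support of \<open>f\<close>
  translated by +i.\<close>

definition block_sum ::
    "'d::finite site set \<Rightarrow> (('d, 's) config \<Rightarrow> real) \<Rightarrow> ('d, 's) config \<Rightarrow> real" where
  "block_sum I f \<sigma> = (\<Sum>i\<in>I. f (shift (- i) \<sigma>))"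

text \<open>If two configurations differ only at \<open>j\<close>, their images under
  \<open>shift (- i)\<close> differ only at j - i. Summing over \<open>I\<close> yields the
  convolution of the oscillations of \<open>f\<close> with the indicator of
  \<open>I\<close>.\<close>

lemma oscillation_block_sum:
  assumes "0 \<le> t"
  shows "oscillation j (\<lambda>\<sigma>. t * block_sum I f \<sigma>) \<le> ennreal t * (\<Sum>i\<in>I. oscillation (j - i) f)"
  unfolding oscillation_def[of j]
proof (rule SUP_least, clarify)
  fix \<sigma> \<eta> :: "('a, 'b) config" assume eq: "\<forall>k. k \<noteq> j \<longrightarrow> \<sigma> k = \<eta> k"
  have "ennreal (t * block_sum I f \<sigma> - t * block_sum I f \<eta>)
      = ennreal t * ennreal (\<Sum>i\<in>I. f (shift (- i) \<sigma>) - f (shift (- i) \<eta>))"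
    using assms by (simp add: block_sum_def sum_subtractf right_diff_distrib flip: ennreal_mult')
  also have "\<dots> \<le> ennreal t * (\<Sum>i\<in>I. ennreal (f (shift (- i) \<sigma>) - f (shift (- i) \<eta>)))"
    by (intro mult_left_mono ennreal_sum_le) auto
  also have "\<dots> \<le> ennreal t * (\<Sum>i\<in>I. oscillation (j - i) f)"
    using eq by (intro mult_left_mono sum_mono le_oscillation) (auto simp: shift_def algebra_simps)
  finally show "ennreal (t * block_sum I f \<sigma> - t * block_sum I f \<eta>) \<le> \<dots>" .
qed

text \<open>Young's inequality; since \<open>\<parallel>\<delta>f\<parallel>\<^sub>1 \<le> 1\<close>, each of the convolution sums is at most 1 and thus
  dominates its square.\<close>
lemma osc_norm2_sq_block_sum:
  assumes t: "0 \<le> t" and norm: "osc_norm1 f \<le> 1"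
  shows "osc_norm2_sq (\<lambda>\<sigma>. t * block_sum I f \<sigma>) \<le> ennreal (t\<^sup>2 * card I)"
  unfolding osc_norm2_sq_def
proof (rule infsum_le_ennreal)
  fix J :: "'a site set" assume J: "finite J"
  have le1: "sum (\<lambda>i. oscillation i f) K \<le> 1" if "finite K" for K
    using sum_le_infsum_ennreal[OF that] norm by (auto simp: osc_norm1_def intro: order_trans)
  let ?s = "\<lambda>j. \<Sum>i\<in>I. oscillation (j - i) f"
  have s1: "?s j \<le> 1" for j
  \<comment> \<open>For finite \<open>I\<close> the sites j - i are distinct, so this is a partial
    sum of \<open>osc_norm1 f\<close>. For infinite \<open>I\<close> the sum is 0 by convention, as
    are \<open>block_sum I f\<close> and \<open>card I\<close>.\<close>
  proof (cases "finite I")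
    case True
    have "?s j = sum (\<lambda>i. oscillation i f) ((\<lambda>i. j - i) ` I)"
      by (subst sum.reindex) (auto simp: inj_on_def)
    also have "\<dots> \<le> 1" using True by (intro le1) auto
    finally show ?thesis .
  qed auto
  have "(\<Sum>j\<in>J. (oscillation j (\<lambda>\<sigma>. t * block_sum I f \<sigma>))\<^sup>2) \<le> (\<Sum>j\<in>J. (ennreal t * ?s j)\<^sup>2)"
    by (intro sum_mono power_mono oscillation_block_sum t) auto
  also have "\<dots> \<le> (\<Sum>j\<in>J. ennreal (t\<^sup>2) * ?s j)"
  proof (rule sum_mono)
    fix j
    have "(ennreal t * ?s j)\<^sup>2 = ennreal (t\<^sup>2) * (?s j * ?s j)"
      using t by (simp add: power2_eq_square ennreal_mult ac_simps)
    also have "\<dots> \<le> ennreal (t\<^sup>2) * (?s j * 1)"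
      by (intro mult_left_mono s1) auto
    finally show "(ennreal t * ?s j)\<^sup>2 \<le> ennreal (t\<^sup>2) * ?s j" by simp
  qed
  \<comment> \<open>After the exchange of sums, each site of \<open>I\<close> contributes a partial
    sum of \<open>osc_norm1 f\<close>, hence at most 1; this produces the factor
    \<open>card I\<close>.\<close>
  also have "\<dots> = ennreal (t\<^sup>2) * (\<Sum>i\<in>I. \<Sum>j\<in>J. oscillation (j - i) f)"
    by (subst sum.swap) (simp add: sum_distrib_left)
  also have "\<dots> \<le> ennreal (t\<^sup>2) * (\<Sum>i\<in>I. 1)"
  proof (intro mult_left_mono sum_mono)
    fix i
    have "(\<Sum>j\<in>J. oscillation (j - i) f) = sum (\<lambda>i. oscillation i f) ((\<lambda>j. j - i) ` J)"
      by (subst sum.reindex) (auto simp: inj_on_def)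
    also have "\<dots> \<le> 1" using J by (intro le1) auto
    finally show "(\<Sum>j\<in>J. oscillation (j - i) f) \<le> 1" .
  qed auto
  also have "\<dots> = ennreal (t\<^sup>2 * card I)"
    by (simp add: ennreal_mult' ennreal_of_nat_eq_real_of_nat)
  finally show "(\<Sum>j\<in>J. (oscillation j (\<lambda>\<sigma>. t * block_sum I f \<sigma>))\<^sup>2) \<le> \<dots>" .
qed

lemma continuous_on_shift: "continuous_on UNIV (shift i)"
  unfolding shift_def by (intro continuous_on_coordinatewise_then_product) simp

lemma local_fun_block_sum:
  fixes f :: "('d::finite, 's::topological_space) config \<Rightarrow> real"
  assumes f: "local_fun f" and I: "finite I" and t: "0 \<le> t"
  shows "local_fun (\<lambda>\<sigma>. t * block_sum I f \<sigma>)"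
  unfolding local_fun_def
proof
  have "continuous_on UNIV (\<lambda>\<sigma>. f (shift (- i) \<sigma>))" for i
    using f unfolding local_fun_def
    by (auto intro: continuous_on_compose2[OF _ continuous_on_shift])
  then show "continuous_on UNIV (\<lambda>\<sigma>. t * block_sum I f \<sigma>)"
    unfolding block_sum_def by (intro continuous_intros)
  \<comment> \<open>The support of the sum of translates lies in the Minkowski sum of
    \<open>I\<close> and the support of \<open>f\<close>, both finite.\<close>
  have "{j. oscillation j (\<lambda>\<sigma>. t * block_sum I f \<sigma>) \<noteq> 0}
      \<subseteq> (\<Union>i\<in>I. (\<lambda>k. k + i) ` {k. oscillation k f \<noteq> 0})"
  proof clarify
    fix j assume "oscillation j (\<lambda>\<sigma>. t * block_sum I f \<sigma>) \<noteq> 0"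
    then have "(\<Sum>i\<in>I. oscillation (j - i) f) \<noteq> 0"
      using oscillation_block_sum[OF t, of j I f] by auto
    then obtain i where "i \<in> I" "oscillation (j - i) f \<noteq> 0"
      by (meson sum.neutral)
    then show "j \<in> (\<Union>i\<in>I. (\<lambda>k. k + i) ` {k. oscillation k f \<noteq> 0})"
      by (intro UN_I[of i] image_eqI[of _ _ "j - i"]) auto
  qed
  then show "finite {j. oscillation j (\<lambda>\<sigma>. t * block_sum I f \<sigma>) \<noteq> 0}"
    using f I by (auto simp: local_fun_def intro: finite_subset)
qed

section \<open>Measurability and translation invariance\<close>

text \<open>There are countably many sites and \<open>'s\<close> is second countable, so the product
  algebra is the Borel algebra. This makes continuous functions measurable for every
  \<open>config_prob\<close> measure.\<close>

lemma sets_config_algebra: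
  "sets (config_algebra :: ('d::finite, 's::second_countable_topology) config measure) = sets borel"
  unfolding config_algebra_def by (rule sets_PiM_equal_borel)

lemma subalgebra_coord_algebra:
  fixes \<mu> :: "('d::finite, 's::topological_space) config measure"
  assumes "config_prob \<mu>"
  shows "subalgebra \<mu> (coord_algebra \<Lambda>)"
proof -
  have s: "sets \<mu> = sets config_algebra" using assms by (simp add: config_prob_def)
  then have sp: "space \<mu> = UNIV"
    using sets_eq_imp_space_eq[OF s] by (simp add: config_algebra_def space_PiM)
  have "{\<eta> :: ('d, 's) config. \<eta> i \<in> A} \<in> sets \<mu>" if "A \<in> sets borel" for i A
  proof -
    have "(\<lambda>\<eta>. \<eta> i) -` A \<inter> space config_algebra \<in> sets (config_algebra :: ('d, 's) config measure)"
      using that unfolding config_algebra_def by (intro measurable_sets[of _ _ borel]) auto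
    then show ?thesis
      unfolding s by (simp add: vimage_def config_algebra_def space_PiM)
  qed
  then have "sigma_sets (space \<mu>) (\<Union>i\<in>\<Lambda>. {{\<eta>. \<eta> i \<in> A} | A. A \<in> sets borel}) \<subseteq> sets \<mu>"
    by (intro sets.sigma_sets_subset) auto
  then show ?thesis
    by (simp add: subalgebra_def coord_algebra_def sp space_measure_of_conv)
qed

text \<open>Freezing all coordinates outside \<open>\<Lambda>\<close> at one fixed value does not
  change \<open>g\<close>. The freezing map is measurable from the coordinate algebra to the full
  product algebra, and \<open>g\<close> is measurable on the latter.\<close>

lemma borel_measurable_coord_algebra:
  fixes g :: "('d::finite, 's::second_countable_topology) config \<Rightarrow> real"
  assumes g: "continuous_on UNIV g"
    and dep: "\<And>\<sigma> \<eta>. (\<And>i. i \<in> \<Lambda> \<Longrightarrow> \<sigma> i = \<eta> i) \<Longrightarrow> g \<sigma> = g \<eta>"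
  shows "g \<in> borel_measurable (coord_algebra \<Lambda>)"
proof -
  define \<rho> :: "('d, 's) config \<Rightarrow> ('d, 's) config"
    where "\<rho> = (\<lambda>\<sigma> i. if i \<in> \<Lambda> then \<sigma> i else undefined)"
  have sp: "space (coord_algebra \<Lambda> :: ('d, 's) config measure) = UNIV"
    by (simp add: coord_algebra_def space_measure_of_conv)
  have coord: "(\<lambda>\<sigma>. \<rho> \<sigma> i) \<in> borel_measurable (coord_algebra \<Lambda>)" for i
  proof (cases "i \<in> \<Lambda>")
    case True
    have "(\<lambda>\<sigma> :: ('d, 's) config. \<sigma> i) \<in> borel_measurable (coord_algebra \<Lambda>)"
    proof (rule measurableI)
      fix A :: "'s set" assume "A \<in> sets borel"
      with True show "(\<lambda>\<sigma>. \<sigma> i) -` A \<inter> space (coord_algebra \<Lambda>)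
          \<in> sets (coord_algebra \<Lambda> :: ('d, 's) config measure)"
        unfolding sp by (auto simp: coord_algebra_def vimage_def sets_measure_of_conv)
    qed simp
    with True show ?thesis by (simp add: \<rho>_def)
  qed (simp add: \<rho>_def)
  have "\<rho> \<in> measurable (coord_algebra \<Lambda>) config_algebra"
    unfolding config_algebra_def by (rule measurable_PiM_single') (auto intro: coord)
  moreover have "g \<in> borel_measurable config_algebra"
    using borel_measurable_continuous_onI[OF g] measurable_cong_sets[OF sets_config_algebra refl]
    by blast
  ultimately have "(\<lambda>\<sigma>. g (\<rho> \<sigma>)) \<in> borel_measurable (coord_algebra \<Lambda>)"
    by (rule measurable_compose)
  moreover have "g (\<rho> \<sigma>) = g \<sigma>" for \<sigma>
    by (rule dep) (simp add: \<rho>_def)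
  ultimately show ?thesis by simp
qed

lemma distr_shift:
  fixes \<mu> :: "('d::finite, 's::second_countable_topology) config measure"
  assumes \<mu>: "config_prob \<mu>" and inv: "translation_invariant \<mu>"
  shows "distr \<mu> \<mu> (shift i) = \<mu>"
proof (rule measure_eqI)
  have s: "sets \<mu> = sets config_algebra" using \<mu> by (simp add: config_prob_def)
  have sp: "space \<mu> = UNIV"
    using sets_eq_imp_space_eq[OF s] by (simp add: config_algebra_def space_PiM)
  have sb: "sets \<mu> = sets borel" using s by (simp add: sets_config_algebra)
  have m: "shift i \<in> measurable \<mu> \<mu>"
    using borel_measurable_continuous_onI[OF continuous_on_shift] measurable_cong_sets[OF sb sb]
    by blast
  fix A assume "A \<in> sets (distr \<mu> \<mu> (shift i))"
  then have A: "A \<in> sets \<mu>" by simp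
  \<comment> \<open>Invariance is stated for images and the push-forward uses preimages; as shifts
    are bijections, a preimage is the image under the inverse shift.\<close>
  have "shift i -` A = shift (- i) ` A"
  proof (intro set_eqI iffI)
    fix \<sigma> assume "\<sigma> \<in> shift i -` A"
    moreover have "\<sigma> = shift (- i) (shift i \<sigma>)" by (simp add: shift_def)
    ultimately show "\<sigma> \<in> shift (- i) ` A" by blast
  qed (auto simp: shift_def)
  then show "emeasure (distr \<mu> \<mu> (shift i)) A = emeasure \<mu> A"
    using A inv s by (simp add: emeasure_distr[OF m A] sp translation_invariant_def)
qed simp

lemma integral_block_sum:
  fixes \<mu> :: "('d::finite, 's::second_countable_topology) config measure"
  assumes \<mu>: "config_prob \<mu>" and inv: "translation_invariant \<mu>"
    and f: "continuous_on UNIV f" and bdd: "bounded (range f)"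
  shows "(\<integral>\<sigma>. block_sum I f \<sigma> \<partial>\<mu>) = card I * (\<integral>\<sigma>. f \<sigma> \<partial>\<mu>)"
proof -
  interpret prob_space \<mu> using \<mu> by (simp add: config_prob_def)
  have sb: "sets \<mu> = sets borel" using \<mu> by (simp add: config_prob_def sets_config_algebra)
  have fm: "f \<in> borel_measurable \<mu>"
    using borel_measurable_continuous_onI[OF f] measurable_cong_sets[OF sb refl] by blast
  have m: "shift i \<in> measurable \<mu> \<mu>" for i
    using borel_measurable_continuous_onI[OF continuous_on_shift] measurable_cong_sets[OF sb sb]
    by blast
  obtain B where B: "\<bar>f \<sigma>\<bar> \<le> B" for \<sigma>
    using bdd by (auto simp: bounded_iff)
  have "integrable \<mu> (\<lambda>\<sigma>. f (shift i \<sigma>))" for i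
    using measurable_compose[OF m fm] by (intro integrable_const_bound[of _ B]) (auto simp: B)
  moreover have "(\<integral>\<sigma>. f (shift i \<sigma>) \<partial>\<mu>) = (\<integral>\<sigma>. f \<sigma> \<partial>\<mu>)" for i
    using integral_distr[OF m fm, of i] by (simp add: distr_shift[OF \<mu> inv])
  ultimately show ?thesis
    unfolding block_sum_def by (subst Bochner_Integration.integral_sum) auto
qed

section \<open>Entropy bounds on boxes and in the limit\<close>

lemma bounded_range_if_osc_norm1_le:
  assumes "local_fun f" "osc_norm1 f \<le> 1"
  shows "bounded (range f)"
proof -
  have "\<bar>f \<sigma>\<bar> \<le> 1 + \<bar>f (\<lambda>_. undefined)\<bar>" for \<sigma>
    using local_fun_diff_le[OF assms, of \<sigma> "\<lambda>_. undefined"]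
      local_fun_diff_le[OF assms, of "\<lambda>_. undefined" \<sigma>] by linarith
  then show ?thesis by (auto simp: bounded_iff)
qed

lemma local_rel_entropy_ge:
  fixes \<mu> \<mu>' :: "('d::finite, 's::second_countable_topology) config measure"
  assumes C: "0 < C" and \<mu>: "config_prob \<mu>" "translation_invariant \<mu>" and GCB: "GCB C \<mu>"
    and \<mu>': "config_prob \<mu>'" "translation_invariant \<mu>'"
    and f: "local_fun f" "osc_norm1 f \<le> 1" and supp: "{i. oscillation i f \<noteq> 0} \<subseteq> box m"
    and n: "m \<le> n"
    and a: "a = (\<integral>\<sigma>. f \<sigma> \<partial>\<mu>') - (\<integral>\<sigma>. f \<sigma> \<partial>\<mu>)" "0 \<le> a"
  shows "ereal (card (box (n - m) :: 'd site set) * (a\<^sup>2 / (2 * C))) \<le> local_rel_entropy (box n) \<mu>' \<mu>"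
proof -
  define I where "I = (box (n - m) :: 'd site set)"
  \<comment> \<open>This is the maximiser of t a - C t^2 / 2. It is nonnegative because
    \<open>a\<close> is, as the oscillation bounds for multiples of \<open>block_sum\<close>
    require.\<close>
  define t where "t = a / C"
  define F where "F = (\<lambda>\<sigma>. t * block_sum I f \<sigma>)"
  have I: "finite I" unfolding I_def by (rule finite_box)
  have t: "0 \<le> t" using C a by (simp add: t_def)
  have fc: "continuous_on UNIV f" using f by (simp add: local_fun_def)
  have fb: "bounded (range f)" by (rule bounded_range_if_osc_norm1_le[OF f])
  have Floc: "local_fun F" unfolding F_def by (rule local_fun_block_sum[OF f(1) I t])
  obtain B where B: "\<bar>f \<sigma>\<bar> \<le> B" for \<sigma>
    using fb by (auto simp: bounded_iff)
  have FB: "\<bar>F \<sigma>\<bar> \<le> t * (card I * B)" for \<sigma>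
    unfolding F_def block_sum_def abs_mult abs_of_nonneg[OF t]
    using B by (intro mult_left_mono t order_trans[OF sum_abs] sum_bounded_above)
  then have Fb: "bounded (range F)" by (auto simp: bounded_iff)
  define A where "A = (\<integral>\<sigma>. F \<sigma> \<partial>\<mu>)"
  have A: "A = t * (card I * (\<integral>\<sigma>. f \<sigma> \<partial>\<mu>))"
    unfolding A_def F_def by (simp add: integral_block_sum[OF \<mu> fc fb])
  have A': "(\<integral>\<sigma>. F \<sigma> \<partial>\<mu>') = t * (card I * (\<integral>\<sigma>. f \<sigma> \<partial>\<mu>'))"
    unfolding F_def by (simp add: integral_block_sum[OF \<mu>' fc fb])
  define K where "K = C / 2 * (t\<^sup>2 * card I)"
  have exp_le: "(\<integral>\<sigma>. exp (F \<sigma> - A) \<partial>\<mu>) \<le> exp K"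
  proof -
    have "enn2real (osc_norm2_sq F) \<le> t\<^sup>2 * card I"
      using osc_norm2_sq_block_sum[OF t f(2), of I]
      unfolding F_def by (intro enn2real_leI) auto
    then have "exp (C / 2 * enn2real (osc_norm2_sq F)) \<le> exp K"
      using C by (simp add: K_def)
    moreover have "(\<integral>\<sigma>. exp (F \<sigma> - A) \<partial>\<mu>) \<le> exp (C / 2 * enn2real (osc_norm2_sq F))"
      using GCB Fb Floc unfolding GCB_def A_def by blast
    ultimately show ?thesis by linarith
  qed
  \<comment> \<open>Measurability on the box lets integrals against the restricted measures be
    evaluated under \<open>\<mu>\<close> and \<open>\<mu>'\<close> themselves.\<close>
  have meas: "F \<in> borel_measurable (coord_algebra (box n))"
  proof (rule borel_measurable_coord_algebra)
    show "continuous_on UNIV F" using Floc by (simp add: local_fun_def)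
    fix \<sigma> \<eta> :: "('d, 's) config" assume eq: "\<And>i. i \<in> box n \<Longrightarrow> \<sigma> i = \<eta> i"
    have "f (shift (- i) \<sigma>) = f (shift (- i) \<eta>)" if "i \<in> I" for i
    proof (rule local_fun_cong[OF f(1)])
      fix k assume "oscillation k f \<noteq> 0"
      \<comment> \<open>The index equals n because m \<le> n: translations by sites of
        \<open>box (n - m)\<close> keep the support of \<open>f\<close> inside
        \<open>box n\<close>.\<close>
      then have "k + i \<in> box (m + (n - m))"
        using that supp by (intro box_add) (auto simp: I_def)
      then show "shift (- i) \<sigma> k = shift (- i) \<eta> k"
        using n eq by (simp add: shift_def)
    qed
    then show "F \<sigma> = F \<eta>" by (simp add: F_def block_sum_def)
  qed
  have meas_diff: "(\<lambda>\<sigma>. F \<sigma> - A) \<in> borel_measurable (coord_algebra (box n))"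
    by (rule borel_measurable_diff[OF meas]) simp
  note sub = subalgebra_coord_algebra[OF \<mu>(1), of "box n"]
  note sub' = subalgebra_coord_algebra[OF \<mu>'(1), of "box n"]
  let ?\<nu> = "restrict_to (box n) \<mu>" and ?\<nu>' = "restrict_to (box n) \<mu>'"
  have "ereal ((\<integral>\<sigma>. F \<sigma> - A \<partial>?\<nu>') - K) \<le> rel_entropy ?\<nu>' ?\<nu>"
  proof (rule rel_entropy_variational)
    show "prob_space ?\<nu>" "prob_space ?\<nu>'"
      using \<mu>(1) \<mu>'(1) sub sub'
      by (auto simp: restrict_to_def config_prob_def intro: prob_space_restr_to_subalg)
    show "sets ?\<nu>' = sets ?\<nu>"
      by (simp add: restrict_to_def sets_restr_to_subalg[OF sub] sets_restr_to_subalg[OF sub'])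
    show "(\<lambda>\<sigma>. F \<sigma> - A) \<in> borel_measurable ?\<nu>"
      unfolding restrict_to_def by (rule measurable_in_subalg[OF sub meas_diff])
    show "\<bar>F \<sigma> - A\<bar> \<le> t * (card I * B) + \<bar>A\<bar>" for \<sigma>
      using FB[of \<sigma>] by linarith
    have "(\<lambda>\<sigma>. exp (F \<sigma> - A)) \<in> borel_measurable (coord_algebra (box n))"
      using meas_diff by measurable
    from integral_subalgebra2[OF sub this] exp_le
    show "(\<integral>\<sigma>. exp (F \<sigma> - A) \<partial>?\<nu>) \<le> exp K"
      by (simp add: restrict_to_def)
  qed
  moreover have "(\<integral>\<sigma>. F \<sigma> - A \<partial>?\<nu>') - K = card I * (a\<^sup>2 / (2 * C))"
  proof -
    interpret prob_space \<mu>' using \<mu>' by (simp add: config_prob_def)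
    from integral_subalgebra2[OF sub' meas_diff]
    have "(\<integral>\<sigma>. F \<sigma> - A \<partial>?\<nu>') = (\<integral>\<sigma>. F \<sigma> - A \<partial>\<mu>')"
      by (simp add: restrict_to_def)
    also have "\<dots> = (\<integral>\<sigma>. F \<sigma> \<partial>\<mu>') - A"
    proof -
      have "integrable \<mu>' F"
        using measurable_from_subalg[OF sub' meas] FB by (intro integrable_const_bound) auto
      then show ?thesis by (simp add: prob_space)
    qed
    also have "\<dots> = t * card I * a"
      unfolding A A' a by (simp add: algebra_simps)
    finally show ?thesis
      using C by (simp add: K_def t_def field_simps power2_eq_square)
  qed
  ultimately show ?thesis by (simp add: local_rel_entropy_def I_def)
qed

lemma lower_entropy_density_ge:
  fixes \<mu> \<mu>' :: "('d::finite, 's::second_countable_topology) config measure"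
  assumes C: "0 < C" and \<mu>: "config_prob \<mu>" "translation_invariant \<mu>" and GCB: "GCB C \<mu>"
    and \<mu>': "config_prob \<mu>'" "translation_invariant \<mu>'"
    and f: "local_fun f" "osc_norm1 f \<le> 1"
    and a: "a = (\<integral>\<sigma>. f \<sigma> \<partial>\<mu>') - (\<integral>\<sigma>. f \<sigma> \<partial>\<mu>)" "0 \<le> a"
  shows "ereal (a\<^sup>2 / (2 * C)) \<le> lower_entropy_density \<mu>' \<mu>"
proof -
  let ?b = "\<lambda>n. real (card (box n :: 'd site set))"
  obtain m where m: "{i. oscillation i f \<noteq> 0} \<subseteq> box m"
    using f(1) finite_subset_box unfolding local_fun_def by blast
  \<comment> \<open>The translations lost near the boundary of \<open>box n\<close> are a vanishing
    fraction of its volume, so the limit has the full constant.\<close>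
  have "(\<lambda>n. ereal (?b (n - m) / ?b n * (a\<^sup>2 / (2 * C)))) \<longlonglongrightarrow> ereal (1 * (a\<^sup>2 / (2 * C)))"
    by (intro tendsto_ereal tendsto_mult box_ratio_tendsto tendsto_const)
  from lim_imp_Liminf[OF sequentially_bot this]
  have "ereal (a\<^sup>2 / (2 * C)) = liminf (\<lambda>n. ereal (?b (n - m) / ?b n * (a\<^sup>2 / (2 * C))))"
    by simp
  also have "\<dots> \<le> liminf (\<lambda>n. local_rel_entropy (box n) \<mu>' \<mu> / ereal (?b n))"
  proof (rule Liminf_mono)
    show "\<forall>\<^sub>F n in sequentially.
        ereal (?b (n - m) / ?b n * (a\<^sup>2 / (2 * C))) \<le> local_rel_entropy (box n) \<mu>' \<mu> / ereal (?b n)"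
      using eventually_ge_at_top[of m]
    proof eventually_elim
      case (elim n)
      have b: "0 < ?b n" by (simp add: card_box)
      have "ereal (?b (n - m) / ?b n * (a\<^sup>2 / (2 * C))) = ereal (?b (n - m) * (a\<^sup>2 / (2 * C))) / ereal (?b n)"
        using b by simp
      also have "\<dots> \<le> local_rel_entropy (box n) \<mu>' \<mu> / ereal (?b n)"
        using b by (intro ereal_divide_right_mono local_rel_entropy_ge[OF C \<mu> GCB \<mu>' f m elim a]) auto
      finally show ?case .
    qed
  qed
  finally show ?thesis by (simp add: lower_entropy_density_def)
qed

theorem proposition3p2:
  fixes \<mu> :: "('d::finite, 's::polish_space) config measure"
    and C :: real
  assumes "bounded (UNIV :: 's set)"
    and "measure_separating {f :: ('d, 's) config \<Rightarrow> real. bounded (range f) \<and> quasi_local f}"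
    and "C > 0"
    and "config_prob \<mu>" and "translation_invariant \<mu>" and "GCB C \<mu>"
  shows "\<forall>\<mu>'. config_prob \<mu>' \<and> translation_invariant \<mu>' \<longrightarrow>
           lower_entropy_density \<mu>' \<mu> \<ge> (local_dist \<mu>' \<mu>)\<^sup>2 / ereal (2 * C)"
proof (intro allI impI)
  fix \<mu>' :: "('d, 's) config measure"
  assume \<mu>': "config_prob \<mu>' \<and> translation_invariant \<mu>'"
  let ?L = "lower_entropy_density \<mu>' \<mu>" and ?d = "local_dist \<mu>' \<mu>"
  let ?a = "\<lambda>f. (\<integral>\<sigma>. f \<sigma> \<partial>\<mu>') - (\<integral>\<sigma>. f \<sigma> \<partial>\<mu>)"
  have bound: "ereal ((?a f)\<^sup>2 / (2 * C)) \<le> ?L"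
    if "local_fun f" "osc_norm1 f \<le> 1" "0 \<le> ?a f" for f
    using lower_entropy_density_ge[OF assms(3-6) _ _ that(1,2) refl that(3)] \<mu>' by simp
  \<comment> \<open>The zero function is admissible. It shows that the distance and the entropy
    density are nonnegative, as needed for squaring the bound on the distance and for excluding the
    value -\<infinity>.\<close>
  have "oscillation i (\<lambda>_ :: ('d, 's) config. 0) = 0" for i
    by (auto simp: oscillation_def intro!: antisym SUP_least)
  then have zero: "local_fun (\<lambda>_ :: ('d, 's) config. 0)" "osc_norm1 (\<lambda>_ :: ('d, 's) config. 0) \<le> 1"
    by (simp_all add: local_fun_def osc_norm1_def)
  have d0: "0 \<le> ?d"
    unfolding local_dist_def using zero by (intro SUP_upper2[of "\<lambda>_. 0"]) auto
  have L0: "0 \<le> ?L" using bound[OF zero] by (simp add: zero_ereal_def)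
  show "?d\<^sup>2 / ereal (2 * C) \<le> ?L"
  proof (cases ?L)
    case (real L)
    have L: "0 \<le> L" using L0 real by simp
    \<comment> \<open>Bounding each candidate by a common square root avoids exchanging the square
      with the supremum; candidates with a negative difference are bounded trivially.\<close>
    have "?d \<le> ereal (sqrt (2 * C * L))"
      unfolding local_dist_def
    proof (rule SUP_least)
      fix f :: "('d, 's) config \<Rightarrow> real"
      assume f: "f \<in> {f. local_fun f \<and> osc_norm1 f \<le> 1}"
      show "ereal (?a f) \<le> ereal (sqrt (2 * C * L))"
      proof (cases "0 \<le> ?a f")
        case True
        then have "(?a f)\<^sup>2 / (2 * C) \<le> L" using bound[of f] f real by simp
        then have "(?a f)\<^sup>2 \<le> 2 * C * L" using \<open>C > 0\<close> by (simp add: field_simps)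
        then show ?thesis using real_le_rsqrt by simp
      next
        case False
        then show ?thesis using \<open>C > 0\<close> L by (smt (verit) ereal_less_eq(3) real_sqrt_ge_zero zero_le_mult_iff)
      qed
    qed
    then obtain d where d: "?d = ereal d" "0 \<le> d" "d \<le> sqrt (2 * C * L)"
      using d0 by (cases ?d) auto
    have "d\<^sup>2 \<le> (sqrt (2 * C * L))\<^sup>2" using d by (intro power_mono) auto
    also have "\<dots> = 2 * C * L" using \<open>C > 0\<close> L by simp
    finally have "d\<^sup>2 / (2 * C) \<le> L" using \<open>C > 0\<close> by (simp add: field_simps)
    then show ?thesis using \<open>C > 0\<close> by (simp add: d(1) real)
  qed (use L0 in auto)
qed

end
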